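(* Let $(X,S)$ be an $S$-metric space and let $\mathcal{I}$ be an admissible ideal of $\mathbb{N}$. (i) If $\mathcal{I}$ satisfies the condition $(AP)$ and a sequence $\{x_n\}_{n\in\mathbb{N}}$ in $X$ is $\mathcal{I}$-localized on a set $M\subset X$, then it is $\mathcal{I}^*$-localized on $M$. (ii) If $X$ has a limit point and every $\mathcal{I}$-localized sequence in $X$ is $\mathcal{I}^*$-localized, then $\mathcal{I}$ has the property $(AP)$.
   Context: An $S$-metric on a nonempty set $X$ is a function $S:X\times X\times X\to[0,\infty)$ such that for all $x,y,z,a\in X$: (i) $S(x,y,z)\ge 0$; (ii) $S(x,y,z)=0$ if and only if $x=y=z$; (iii) $S(x,y,z)\le S(x,x,a)+S(y,y,a)+S(z,z,a)$. The pair $(X,S)$ is called an $S$-metric space. A point $\xi\in X$ is a limit point of $X$ if for every $\varepsilon>0$ there is $y\in X$, $y\neq\xi$, with $S(y,y,\xi)<\varepsilon$. An ideal $\mathcal{I}$ of $\mathbb{N}$ is a collection of subsets of $\mathbb{N}$ closed under finite unions and under taking subsets; it is non-trivial if it is neither $\{\emptyset\}$ nor $2^{\mathbb{N}}$, and admissible if it is non-trivial and $\{n\}\in\mathcal{I}$ for every $n\in\mathbb{N}$. The associated filter is $\mathcal{F}(\mathcal{I})=\{A\subset\mathbb{N}:\mathbb{N}\setminus A\in\mathcal{I}\}$. An admissible ideal $\mathcal{I}$ satisfies the condition (has the property) $(AP)$ if for every countable family $\{A_1,A_2,\ldots\}$ of sets in $\mathcal{I}$ there is a countable family $\{B_1,B_2,\ldots\}$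 of subsets of $\mathbb{N}$ such that $A_i\triangle B_i$ is finite for each $i\in\mathbb{N}$ and $\bigcup_{i\in\mathbb{N}}B_i\in\mathcal{I}$. A real sequence $\{a_n\}_{n\in\mathbb{N}}$ is $\mathcal{I}$-convergent to $a\in\mathbb{R}$ if $\{n\in\mathbb{N}:|a_n-a|\ge\varepsilon\}\in\mathcal{I}$ for every $\varepsilon>0$. It is $\mathcal{I}^*$-convergent to $a$ if there is a set $\{m_1<m_2<\cdots\}\in\mathcal{F}(\mathcal{I})$ with $\lim_{k\to\infty}a_{m_k}=a$. A sequence $\{x_n\}_{n\in\mathbb{N}}$ in $X$ is $\mathcal{I}$-localized (respectively $\mathcal{I}^*$-localized) on $M\subset X$ if for each $x\in M$ the real sequence $\{S(x_n,x_n,x)\}_{n\in\mathbb{N}}$ is $\mathcal{I}$-convergent (respectively $\mathcal{I}^*$-convergent). When no subset is mentioned, $M=X$ is meant. *)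

theory Defs
  imports Complex_Main
begin

locale S_metric_space =
  fixes X :: "'a set" and S :: "'a \<Rightarrow> 'a \<Rightarrow> 'a \<Rightarrow> real"
  assumes nonempty: "X \<noteq> {}"
    and nonneg: "\<lbrakk>x \<in> X; y \<in> X; z \<in> X\<rbrakk> \<Longrightarrow> 0 \<le> S x y z"
    and zero_iff: "\<lbrakk>x \<in> X; y \<in> X; z \<in> X\<rbrakk> \<Longrightarrow> S x y z = 0 \<longleftrightarrow> x = y \<and> y = z"
    and triangle: "\<lbrakk>x \<in> X; y \<in> X; z \<in> X; a \<in> X\<rbrakk> \<Longrightarrow> S x y z \<le> S x x a + S y y a + S z z a"

definition S_limit_point :: "'a set \<Rightarrow> ('a \<Rightarrow> 'a \<Rightarrow> 'a \<Rightarrow> real) \<Rightarrow> 'a \<Rightarrow> bool" where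
  "S_limit_point X S \<xi> \<longleftrightarrow> \<xi> \<in> X \<and> (\<forall>\<epsilon>>0. \<exists>y\<in>X. y \<noteq> \<xi> \<and> S y y \<xi> < \<epsilon>)"

definition set_ideal :: "nat set set \<Rightarrow> bool" where
  "set_ideal I \<longleftrightarrow> (\<forall>A\<in>I. \<forall>B\<in>I. A \<union> B \<in> I) \<and> (\<forall>A\<in>I. \<forall>B. B \<subseteq> A \<longrightarrow> B \<in> I)"

definition nontrivial_ideal :: "nat set set \<Rightarrow> bool" where
  "nontrivial_ideal I \<longleftrightarrow> set_ideal I \<and> I \<noteq> {{}} \<and> I \<noteq> UNIV"

definition admissible_ideal :: "nat set set \<Rightarrow> bool" where
  "admissible_ideal I \<longleftrightarrow> nontrivial_ideal I \<and> (\<forall>n. {n} \<in> I)"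

definition ideal_filter :: "nat set set \<Rightarrow> nat set set" where
  "ideal_filter I = {A. - A \<in> I}"

text \<open>A countable family is a sequence of sets, possibly with repetitions; disjointness is not required.\<close>

definition ideal_AP :: "nat set set \<Rightarrow> bool" where
  "ideal_AP I \<longleftrightarrow>
    (\<forall>A :: nat \<Rightarrow> nat set. (\<forall>i. A i \<in> I) \<longrightarrow>
      (\<exists>B :: nat \<Rightarrow> nat set. (\<forall>i. finite (sym_diff (A i) (B i))) \<and> (\<Union>i. B i) \<in> I))"

definition I_converges_to :: "nat set set \<Rightarrow> (nat \<Rightarrow> real) \<Rightarrow> real \<Rightarrow> bool" where
  "I_converges_to I a l \<longleftrightarrow> (\<forall>\<epsilon>>0. {n. \<bar>a n - l\<bar> \<ge> \<epsilon>} \<in> I)"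

text \<open>An index set \<open>{m\<^sub>1 < m\<^sub>2 < \<dots>}\<close> is given by its increasing enumeration.\<close>

definition Istar_converges_to :: "nat set set \<Rightarrow> (nat \<Rightarrow> real) \<Rightarrow> real \<Rightarrow> bool" where
  "Istar_converges_to I a l \<longleftrightarrow>
    (\<exists>m :: nat \<Rightarrow> nat. strict_mono m \<and> range m \<in> ideal_filter I \<and> (\<lambda>k. a (m k)) \<longlonglongrightarrow> l)"

definition I_localized_on ::
  "('a \<Rightarrow> 'a \<Rightarrow> 'a \<Rightarrow> real) \<Rightarrow> nat set set \<Rightarrow> (nat \<Rightarrow> 'a) \<Rightarrow> 'a set \<Rightarrow> bool" where
  "I_localized_on S I x M \<longleftrightarrow> (\<forall>p\<in>M. \<exists>l. I_converges_to I (\<lambda>n. S (x n) (x n) p) l)"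

definition Istar_localized_on ::
  "('a \<Rightarrow> 'a \<Rightarrow> 'a \<Rightarrow> real) \<Rightarrow> nat set set \<Rightarrow> (nat \<Rightarrow> 'a) \<Rightarrow> 'a set \<Rightarrow> bool" where
  "Istar_localized_on S I x M \<longleftrightarrow> (\<forall>p\<in>M. \<exists>l. Istar_converges_to I (\<lambda>n. S (x n) (x n) p) l)"

end

theory Submission
  imports Defs "HOL-Library.Infinite_Set"
begin

text \<open>
  For (i), apply (AP) to the sets \<open>A i = {n. \<bar>a n - l\<bar> \<ge> 1/(i+1)}\<close>: off the union of the
  resulting sets \<open>B i\<close>, only finitely many indices lie in each \<open>A i\<close>.

  For (ii), given sets \<open>A i\<close> in the ideal and a limit point \<open>\<xi>\<close>, choose \<open>y j \<noteq> \<xi>\<close> converging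
  to \<open>\<xi>\<close> and put \<open>x n = y j\<close> for the least \<open>j\<close> with \<open>n \<in> A j\<close>, and \<open>x n = \<xi>\<close> if there is none.
  This sequence is localized. Its distance to \<open>\<xi>\<close> is bounded below by a positive constant on
  each \<open>A j\<close> and tends to \<open>0\<close> along some \<open>C\<close> in the filter, so \<open>A j \<inter> C\<close> is finite and
  \<open>B j = A j - C\<close> witnesses (AP).
\<close>

lemma ideal_subset:
  assumes "admissible_ideal I" "A \<in> I" "B \<subseteq> A"
  shows "B \<in> I"
  using assms unfolding admissible_ideal_def nontrivial_ideal_def set_ideal_def by blast

lemma ideal_Un:
  assumes "admissible_ideal I" "A \<in> I" "B \<in> I"
  shows "A \<union> B \<in> I"
  using assms unfolding admissible_ideal_def nontrivial_ideal_def set_ideal_def by blast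

lemma ideal_singleton: "admissible_ideal I \<Longrightarrow> {n} \<in> I"
  by (simp add: admissible_ideal_def)

lemma ideal_empty: "admissible_ideal I \<Longrightarrow> {} \<in> I"
  using ideal_subset ideal_singleton by blast

lemma ideal_UN:
  assumes "admissible_ideal I" "finite J" "\<And>j. j \<in> J \<Longrightarrow> A j \<in> I"
  shows "(\<Union>j\<in>J. A j) \<in> I"
  using assms(2,3) by (induction J) (auto intro: ideal_empty ideal_Un assms(1))

lemma ideal_finite:
  assumes "admissible_ideal I" "finite A"
  shows "A \<in> I"
  using ideal_UN[OF assms, of "\<lambda>n. {n}"] ideal_singleton[OF assms(1)] by simp

text \<open>If \<open>C\<close> and its complement both lay in \<open>I\<close>, so would their
  union, the whole of \<nat>, and \<open>I\<close> would be trivial.\<close>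

lemma filter_not_in_ideal:
  assumes "admissible_ideal I" "C \<in> ideal_filter I"
  shows "C \<notin> I"
proof
  assume "C \<in> I"
  then have "C \<union> - C \<in> I"
    using assms by (intro ideal_Un) (auto simp: ideal_filter_def)
  then have "I = UNIV"
    using ideal_subset[OF assms(1)] by auto
  then show False
    using assms(1) by (simp add: admissible_ideal_def nontrivial_ideal_def)
qed

lemma tendsto_iff_finite_exceptions:
  fixes f :: "nat \<Rightarrow> real"
  shows "f \<longlonglongrightarrow> l \<longleftrightarrow> (\<forall>\<epsilon>>0. finite {k. \<epsilon> \<le> \<bar>f k - l\<bar>})"
  unfolding tendsto_iff dist_real_def cofinite_eq_sequentially[symmetric] eventually_cofinite not_less
  by (rule refl)

text \<open>Replaces the enumeration by its range: an injective \<open>m\<close> carries the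
  exceptional indices \<open>k\<close> bijectively onto the exceptional points of
  \<open>range m\<close>, so finiteness is the same on both sides.\<close>

lemma Istar_converges_to_iff:
  assumes "admissible_ideal I"
  shows "Istar_converges_to I a l \<longleftrightarrow>
    (\<exists>C\<in>ideal_filter I. \<forall>\<epsilon>>0. finite {n \<in> C. \<epsilon> \<le> \<bar>a n - l\<bar>})"
proof -
  have exceptions: "(\<lambda>k. a (m k)) \<longlonglongrightarrow> l \<longleftrightarrow> (\<forall>\<epsilon>>0. finite {n \<in> range m. \<epsilon> \<le> \<bar>a n - l\<bar>})"
    if "strict_mono m" for m :: "nat \<Rightarrow> nat"
  proof -
    have "finite (m ` K) \<longleftrightarrow> finite K" for K
      using that by (meson finite_image_iff inj_on_subset strict_mono_imp_inj_on subset_UNIV)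
    moreover have "{n \<in> range m. \<epsilon> \<le> \<bar>a n - l\<bar>} = m ` {k. \<epsilon> \<le> \<bar>a (m k) - l\<bar>}" for \<epsilon>
      by auto
    ultimately show ?thesis
      by (simp add: tendsto_iff_finite_exceptions)
  qed
  show ?thesis
  proof
    assume "Istar_converges_to I a l"
    then show "\<exists>C\<in>ideal_filter I. \<forall>\<epsilon>>0. finite {n \<in> C. \<epsilon> \<le> \<bar>a n - l\<bar>}"
      unfolding Istar_converges_to_def using exceptions by blast
  next
    assume "\<exists>C\<in>ideal_filter I. \<forall>\<epsilon>>0. finite {n \<in> C. \<epsilon> \<le> \<bar>a n - l\<bar>}"
    then obtain C where C: "C \<in> ideal_filter I" "\<forall>\<epsilon>>0. finite {n \<in> C. \<epsilon> \<le> \<bar>a n - l\<bar>}"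
      by blast
    \<comment> \<open>Only an infinite set has a strictly increasing enumeration; finite sets lie in
      \<open>I\<close>, and a member of the filter does not.\<close>
    have "infinite C"
      using filter_not_in_ideal[OF assms C(1)] ideal_finite[OF assms] by blast
    then have "strict_mono (enumerate C)" "range (enumerate C) = C"
      by (simp_all add: strict_mono_enumerate range_enumerate)
    then show "Istar_converges_to I a l"
      unfolding Istar_converges_to_def using exceptions C by metis
  qed
qed

lemma AP_imp_Istar_converges_to:
  assumes I: "admissible_ideal I" and AP: "ideal_AP I" and conv: "I_converges_to I a l"
  shows "Istar_converges_to I a l"
proof -
  define A where "A i = {n. 1 / real (Suc i) \<le> \<bar>a n - l\<bar>}" for i
  have "A i \<in> I" for i
    using conv unfolding A_def I_converges_to_def by simp
  then obtain B where B: "\<And>i. finite (sym_diff (A i) (B i))" "(\<Union>i. B i) \<in> I"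
    using AP unfolding ideal_AP_def by metis
  have "finite {n \<in> - (\<Union>i. B i). \<epsilon> \<le> \<bar>a n - l\<bar>}" if "\<epsilon> > 0" for \<epsilon>
  proof -
    obtain i where "1 / real (Suc i) < \<epsilon>"
      using nat_approx_posE[OF \<open>\<epsilon> > 0\<close>] by blast
    \<comment> \<open>A deviation of at least \<epsilon> puts \<open>n\<close> into
      \<open>A i\<close>, and \<open>n\<close> avoids every \<open>B i\<close>, so it lies in
      \<open>A i - B i\<close>.\<close>
    then have "{n \<in> - (\<Union>i. B i). \<epsilon> \<le> \<bar>a n - l\<bar>} \<subseteq> sym_diff (A i) (B i)"
      by (auto simp: A_def)
    then show ?thesis
      using B(1) finite_subset by blast
  qed
  then show ?thesis
    unfolding Istar_converges_to_iff[OF I]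
    using B(2) by (intro bexI[of _ "- (\<Union>i. B i)"]) (auto simp: ideal_filter_def)
qed

text \<open>Identifies the unspecified limit supplied by \<open>Istar_localized_on\<close>. With
  distinct limits, no value is within half their distance of both, so a filter set would be covered
  by a finite set and a member of \<open>I\<close>.\<close>

lemma Istar_limit_eq:
  assumes I: "admissible_ideal I" and conv: "I_converges_to I a l" and star: "Istar_converges_to I a l'"
  shows "l' = l"
proof (rule ccontr)
  assume "l' \<noteq> l"
  define \<delta> where "\<delta> = \<bar>l' - l\<bar> / 2"
  have "\<delta> > 0"
    using \<open>l' \<noteq> l\<close> by (simp add: \<delta>_def)
  obtain C where C: "C \<in> ideal_filter I" "finite {n \<in> C. \<delta> \<le> \<bar>a n - l'\<bar>}"
    using star \<open>\<delta> > 0\<close> unfolding Istar_converges_to_iff[OF I] by blast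
  have "{n. \<delta> \<le> \<bar>a n - l\<bar>} \<in> I"
    using conv \<open>\<delta> > 0\<close> unfolding I_converges_to_def by blast
  then have "{n \<in> C. \<delta> \<le> \<bar>a n - l'\<bar>} \<union> {n. \<delta> \<le> \<bar>a n - l\<bar>} \<in> I"
    using ideal_Un[OF I] ideal_finite[OF I C(2)] by blast
  moreover have "C \<subseteq> {n \<in> C. \<delta> \<le> \<bar>a n - l'\<bar>} \<union> {n. \<delta> \<le> \<bar>a n - l\<bar>}"
    unfolding \<delta>_def by (auto simp: abs_if split: if_splits)
  ultimately show False
    using ideal_subset[OF I] filter_not_in_ideal[OF I C(1)] by blast
qed

context S_metric_space
begin

lemma dist_self: "x \<in> X \<Longrightarrow> S x x x = 0"
  by (simp add: zero_iff)

text \<open>Taking the auxiliary point \<open>a\<close> equal to the repeated argument makes two of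
  the three terms in \<open>triangle\<close> vanish.\<close>

lemma dist_commute: "S x x y = S y y x" if "x \<in> X" "y \<in> X"
  using triangle[of x x y x] triangle[of y y x y] that by (simp add: dist_self)

text \<open>Apply \<open>triangle\<close> through \<xi> and through \<open>u\<close>; the factor 2
  comes from the repeated first argument. The bound does not depend on \<open>p\<close>, so
  closeness to \<xi> controls the distances to all points at once.\<close>

lemma abs_dist_diff_le:
  assumes "u \<in> X" "\<xi> \<in> X" "p \<in> X"
  shows "\<bar>S u u p - S \<xi> \<xi> p\<bar> \<le> 2 * S u u \<xi>"
  using triangle[of u u p \<xi>] triangle[of \<xi> \<xi> p u] assms
    dist_commute[of p \<xi>] dist_commute[of p u] dist_commute[of \<xi> u] by linarith

lemma I_localized_imp_Istar_imp_AP: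
  assumes I: "admissible_ideal I" and "S_limit_point X S \<xi>"
    and star: "\<And>x. range x \<subseteq> X \<Longrightarrow> I_localized_on S I x X \<Longrightarrow> Istar_localized_on S I x X"
  shows "ideal_AP I"
  unfolding ideal_AP_def
proof (intro allI impI)
  fix A :: "nat \<Rightarrow> nat set"
  assume A: "\<forall>i. A i \<in> I"
  have \<xi>: "\<xi> \<in> X"
    and "\<forall>j. \<exists>y\<in>X. y \<noteq> \<xi> \<and> S y y \<xi> < 1 / real (Suc j)"
    using assms(2) unfolding S_limit_point_def by simp_all
  then obtain y where y: "\<And>j. y j \<in> X" "\<And>j. y j \<noteq> \<xi>" "\<And>j. S (y j) (y j) \<xi> < 1 / real (Suc j)"
    by metis
  \<comment> \<open>The least index matters for the lower bound: on \<open>A j\<close> only the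
    values \<open>y 0\<close>, ..., \<open>y j\<close> occur, all different from \<xi>.\<close>
  define x where "x n = (if \<exists>j. n \<in> A j then y (LEAST j. n \<in> A j) else \<xi>)" for n
  have x_in: "x n \<in> X" for n
    using y \<xi> by (simp add: x_def)
  have conv: "I_converges_to I (\<lambda>n. S (x n) (x n) p) (S \<xi> \<xi> p)" if "p \<in> X" for p
    unfolding I_converges_to_def
  proof (intro allI impI)
    fix \<epsilon> :: real
    assume "\<epsilon> > 0"
    then obtain J where J: "1 / real (Suc J) < \<epsilon> / 2"
      using nat_approx_posE[of "\<epsilon> / 2"] by auto
    have "n \<in> (\<Union>j<J. A j)" if "\<epsilon> \<le> \<bar>S (x n) (x n) p - S \<xi> \<xi> p\<bar>" for n
    proof -
      have far: "\<epsilon> / 2 \<le> S (x n) (x n) \<xi>"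
        using that abs_dist_diff_le[OF x_in \<xi> \<open>p \<in> X\<close>, of n] by linarith
      \<comment> \<open>Outside all \<open>A j\<close> the default value \<xi> has distance 0 from
        itself, which is below \<epsilon>/2.\<close>
      then have ex: "\<exists>j. n \<in> A j"
        using \<open>\<epsilon> > 0\<close> \<xi> by (auto simp: x_def dist_self split: if_splits)
      define k where "k = (LEAST j. n \<in> A j)"
      have "n \<in> A k" "x n = y k"
        using ex by (auto simp: k_def x_def intro: LeastI_ex)
      moreover have "k < J"
      proof (rule ccontr)
        assume "\<not> k < J"
        then have "1 / real (Suc k) \<le> 1 / real (Suc J)"
          by (simp add: frac_le)
        with far J y(3)[of k] \<open>x n = y k\<close> show False
          by simp
      qed
      ultimately show ?thesis
        by blast
    qed
    then have "{n. \<epsilon> \<le> \<bar>S (x n) (x n) p - S \<xi> \<xi> p\<bar>} \<subseteq> (\<Union>j<J. A j)"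
      by blast
    moreover have "(\<Union>j<J. A j) \<in> I"
      using A by (intro ideal_UN[OF I]) auto
    ultimately show "{n. \<epsilon> \<le> \<bar>S (x n) (x n) p - S \<xi> \<xi> p\<bar>} \<in> I"
      using ideal_subset[OF I] by blast
  qed
  then have "I_localized_on S I x X"
    unfolding I_localized_on_def by blast
  then have "Istar_localized_on S I x X"
    using star x_in by blast
  then obtain l where l: "Istar_converges_to I (\<lambda>n. S (x n) (x n) \<xi>) l"
    using \<xi> unfolding Istar_localized_on_def by blast
  \<comment> \<open>At \<open>p\<close> = \<xi> the ideal limit found above is
    \<open>S \<xi> \<xi> \<xi>\<close>.\<close>
  have "l = 0"
    using Istar_limit_eq[OF I conv[OF \<xi>] l] \<xi> by (simp add: dist_self)
  then obtain C where C: "C \<in> ideal_filter I"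
    and small: "\<And>\<epsilon>. \<epsilon> > 0 \<Longrightarrow> finite {n \<in> C. \<epsilon> \<le> \<bar>S (x n) (x n) \<xi>\<bar>}"
    using l unfolding Istar_converges_to_iff[OF I] by auto
  have "finite (A j \<inter> C)" for j
  proof -
    define \<delta> where "\<delta> = Min ((\<lambda>k. S (y k) (y k) \<xi>) ` {..j})"
    have "0 < S (y k) (y k) \<xi>" for k
      using nonneg[of "y k" "y k" \<xi>] zero_iff[of "y k" "y k" \<xi>] y(1,2)[of k] \<xi>
      by (simp add: order_less_le)
    then have "\<delta> > 0"
      unfolding \<delta>_def by (subst Min_gr_iff) auto
    have "\<delta> \<le> S (x n) (x n) \<xi>" if "n \<in> A j" for n
    proof -
      have "(LEAST j. n \<in> A j) \<le> j"
        using that by (rule Least_le)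
      moreover have "x n = y (LEAST j. n \<in> A j)"
        using that by (auto simp: x_def)
      ultimately show ?thesis
        unfolding \<delta>_def by (intro Min_le) auto
    qed
    then have "A j \<inter> C \<subseteq> {n \<in> C. \<delta> \<le> \<bar>S (x n) (x n) \<xi>\<bar>}"
      by force
    then show ?thesis
      using small[OF \<open>\<delta> > 0\<close>] finite_subset by blast
  qed
  moreover have "sym_diff (A j) (A j - C) = A j \<inter> C" for j
    by blast
  \<comment> \<open>The union stays inside the complement of \<open>C\<close>, which belongs to
    \<open>I\<close>.\<close>
  moreover have "(\<Union>j. A j - C) \<in> I"
    by (rule ideal_subset[OF I, of "- C"]) (use C in \<open>auto simp: ideal_filter_def\<close>)
  ultimately show "\<exists>B. (\<forall>i. finite (sym_diff (A i) (B i))) \<and> (\<Union>i. B i) \<in> I"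
    by (intro exI[of _ "\<lambda>j. A j - C"]) simp
qed

end

theorem theorem3p2:
  fixes X :: "'a set" and S :: "'a \<Rightarrow> 'a \<Rightarrow> 'a \<Rightarrow> real" and I :: "nat set set"
  assumes "S_metric_space X S" and "admissible_ideal I"
  shows "(ideal_AP I \<longrightarrow>
           (\<forall>(x :: nat \<Rightarrow> 'a) M. range x \<subseteq> X \<longrightarrow> M \<subseteq> X \<longrightarrow>
              I_localized_on S I x M \<longrightarrow> Istar_localized_on S I x M))
       \<and> ((\<exists>\<xi>. S_limit_point X S \<xi>) \<and>
           (\<forall>x :: nat \<Rightarrow> 'a. range x \<subseteq> X \<longrightarrow>
              I_localized_on S I x X \<longrightarrow> Istar_localized_on S I x X)
           \<longrightarrow> ideal_AP I)"
proof (intro conjI impI allI)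
  fix x :: "nat \<Rightarrow> 'a" and M
  assume "ideal_AP I" "I_localized_on S I x M"
  then show "Istar_localized_on S I x M"
    using AP_imp_Istar_converges_to[OF assms(2)]
    unfolding I_localized_on_def Istar_localized_on_def by blast
next
  assume "(\<exists>\<xi>. S_limit_point X S \<xi>) \<and>
    (\<forall>x :: nat \<Rightarrow> 'a. range x \<subseteq> X \<longrightarrow>
      I_localized_on S I x X \<longrightarrow> Istar_localized_on S I x X)"
  then show "ideal_AP I"
    using S_metric_space.I_localized_imp_Istar_imp_AP[OF assms] by blast
qed

end
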